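(* Let $\Gamma$ be an e-graph. Under the canonical identification of the medial digraph of the mind-body dual $\Gamma^*$ with the medial digraph $\mathcal{M}(\Gamma)$, the perfect chain decomposition (PCD) that the local edge order of $\Gamma^{*}$ induces on $\mathcal{M}(\Gamma)$ is the dual PCD $\mathcal{C}^*$ of the PCD $\mathcal{C}$ that the local edge order of $\Gamma$ induces on $\mathcal{M}(\Gamma)$.
   Context: Graphs are finite and loopless; multiple edges are allowed. An e-graph of size $m$ is a graph with $m$ edges labeled bijectively by $[m]=\{1,\dots,m\}$; at each vertex the incident edges are linearly ordered by their labels (this is the local edge order, or leo, of the e-graph). Migts. For a vertex $v$ the minimally increasing greedy trail (migt) $\overrightarrow{v}$ starts at $v$ along the smallest edge at $v$; after arriving at a vertex $w$ along an edge $e$ it continues with the smallest edge at $w$ larger than $e$, and stops if $e$ is the largest edge at $w$. If $v$ is isolated, $\overrightarrow{v}$ is the trivial trail of length $0$. Every edge belongs to exactly two migts. Mind-body dual. $\Gamma^*$ is the e-graph whose vertices are the migts of $\Gamma$ (one for each vertex $v$, written $v^*=\overrightarrow{v}$) and which has, for each $i\in[m]$, an edge labeled $i$ joining the two migts that contain the edge of $\Gamma$ labeled $i$; the edge of $\Gamma^*$ corresponding to $e$ is written $e^*$. Medial digraph. $\mathcal{M}(\Gamma)$ has as vertices the edges of $\Gamma$, and for each vertex $v$ of $\Gamma$ with incident edges $e_1<\dots<e_d$ it has arcs $e_j\to e_{j+1}$, $1\le j<d$ (arcs contributed by different vertices are considered different, even if parallel). It is acyclic, and each of its vertices has in- and out-degree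 at most $2$ (it is a binary digraph). A vertex of a binary digraph is internal if its in- and out-degrees are both at least $1$. PCD. A perfect chain decomposition of a binary digraph $M$ is a decomposition of its arcs into chains (directed paths; chains of length $0$ are allowed) such that every vertex belongs to exactly two chains. PCD induced by the leo of $\Gamma$: one chain $e_1\to\dots\to e_d$ for each vertex $v$ of positive degree, consisting of the arcs contributed by $v$. PCD induced on $\mathcal{M}(\Gamma)$ by the leo of $\Gamma^*$: one chain $f_1\to\dots\to f_k$ for each nontrivial migt $t$ of $\Gamma$ with successive edges $f_1,\dots,f_k$ (the edges of $\Gamma^*$ at the vertex $t$ are $f_1^*<\dots<f_k^*$), where the arc $f_j\to f_{j+1}$ is the one contributed by the vertex of $\Gamma$ at which $t$ passes from $f_j$ to $f_{j+1}$; this is the identification of $\mathcal{M}(\Gamma^* )$ with $\mathcal{M}(\Gamma)$. Dual PCD. At each internal vertex $a$ a PCD makes one of exactly two possible choices: bidegree (in, out) $(1,1)$: the incoming and the outgoing arc are consecutive in one chain (and the other chain at $a$ is trivial), or they belong to two different chains, one ending and the other starting at $a$; bidegree $(1,2)$: the incoming arc is continued by one or by the other outgoing arc; bidegree $(2,1)$: the outgoing arc continues one or the other incoming arc; bidegree $(2,2)$: the two incoming arcs are continued by the two outgoing arcs according to one or the other of the two matchings. At non-internal vertices there is no choice, so a PCD is determined by its choices at internal vertices. The dual $\mathcal{C}^*$ of a PCD $\mathcal{C}$ is the PCD that makes the opposite choice at every internal vertex. *)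

theory Defs
  imports "HOL-Library.Multiset" "Graph_Theory.Digraph_Isomorphism"
begin

text \<open>The edges of an e-graph of size $m$ are identified with their labels $1, \dots, m$;
  \<open>ends G i\<close> is the set of end vertices of the edge labeled \<open>i\<close>.\<close>

record 'v egraph =
  everts :: "'v set"
  esize :: nat
  ends :: "nat \<Rightarrow> 'v set"

definition eedges :: "'v egraph \<Rightarrow> nat set" where
  "eedges G = {1..esize G}"

definition is_egraph :: "'v egraph \<Rightarrow> bool" where
  "is_egraph G \<longleftrightarrow> finite (everts G) \<and>
     (\<forall>i \<in> eedges G. ends G i \<subseteq> everts G \<and> card (ends G i) = 2)"

text \<open>Local edge order.\<close>

definition leo :: "'v egraph \<Rightarrow> 'v \<Rightarrow> nat list" where
  "leo G v = sorted_list_of_set {i \<in> eedges G. v \<in> ends G i}"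

definition other_end :: "'v egraph \<Rightarrow> nat \<Rightarrow> 'v \<Rightarrow> 'v" where
  "other_end G e v = the_elem (ends G e - {v})"

text \<open>A trail is given by its start vertex and its list of steps, a step being the traversed
  edge together with the vertex at which the trail arrives along it.\<close>

type_synonym 'v etrail = "'v \<times> (nat \<times> 'v) list"

definition trail_edges :: "'v etrail \<Rightarrow> nat list" where
  "trail_edges t = map fst (snd t)"

text \<open>\<open>migt_steps G v e\<close> continues a minimally increasing greedy trail that has arrived at
  \<open>v\<close> along \<open>e\<close>. Since labels are positive, \<open>e = 0\<close> gives the trail starting at \<open>v\<close>.\<close>

function migt_steps :: "'v egraph \<Rightarrow> 'v \<Rightarrow> nat \<Rightarrow> (nat \<times> 'v) list" where
  "migt_steps G v e =
     (case filter (\<lambda>f. e < f) (leo G v) of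
        [] \<Rightarrow> []
      | f # _ \<Rightarrow> (f, other_end G f v) # migt_steps G (other_end G f v) f)"
  by pat_completeness auto
termination
proof (relation "measure (\<lambda>(G, v, e). esize G - e)")
  show "wf (measure (\<lambda>(G :: 'v egraph, v :: 'v, e). esize G - e))" by simp
next
  fix G :: "'v egraph" and v :: 'v and e f :: nat and fs
  assume "filter (\<lambda>f. e < f) (leo G v) = f # fs"
  then have "f \<in> set (filter (\<lambda>f. e < f) (leo G v))" by simp
  then have "e < f" "f \<le> esize G"
    by (auto simp: leo_def eedges_def)
  then show "((G, other_end G f v, f), (G, v, e)) \<in> measure (\<lambda>(G, v, e). esize G - e)"
    by simp
qed

declare migt_steps.simps [simp del]

definition migt :: "'v egraph \<Rightarrow> 'v \<Rightarrow> 'v etrail" where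
  "migt G v = (v, migt_steps G v 0)"

definition mind_body_dual :: "'v egraph \<Rightarrow> 'v etrail egraph" where
  "mind_body_dual G =
     \<lparr> everts = migt G ` everts G,
       esize = esize G,
       ends = (\<lambda>i. {t \<in> migt G ` everts G. i \<in> set (trail_edges t)}) \<rparr>"

definition consecutive :: "'a list \<Rightarrow> ('a \<times> 'a) list" where
  "consecutive xs = zip xs (tl xs)"

text \<open>The arc \<open>(v, e, f)\<close> is the arc $e \to f$ contributed by the vertex \<open>v\<close>.\<close>

definition medial :: "'v egraph \<Rightarrow> (nat, 'v \<times> nat \<times> nat) pre_digraph" where
  "medial G =
     \<lparr> verts = eedges G,
       arcs = {(v, e, f). v \<in> everts G \<and> (e, f) \<in> set (consecutive (leo G v))},
       tail = (\<lambda>(v, e, f). e),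
       head = (\<lambda>(v, e, f). f) \<rparr>"

text \<open>The identification of the medial digraph of the mind-body dual with that of \<open>G\<close>:
  the edge labeled \<open>i\<close> of the dual is sent to the edge labeled \<open>i\<close>, and the arc $f \to g$
  contributed by the migt \<open>t\<close> to the arc $f \to g$ contributed by the vertex at which \<open>t\<close>
  passes from \<open>f\<close> to \<open>g\<close>, which is the vertex at which \<open>t\<close> arrives along \<open>f\<close>.\<close>

definition medial_ident ::
    "(nat, 'v etrail \<times> nat \<times> nat, nat, 'v \<times> nat \<times> nat) digraph_isomorphism" where
  "medial_ident =
     \<lparr> iso_verts = (\<lambda>i. i),
       iso_arcs = (\<lambda>(t, f, g). (the (map_of (snd t) f), f, g)),
       iso_head = (\<lambda>(v, e, f). f),
       iso_tail = (\<lambda>(v, e, f). e) \<rparr>"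

text \<open>A chain is given by its start vertex and its list of arcs. Decompositions are multisets
  of chains because the same trivial chain may have to be used twice, at an isolated vertex.\<close>

type_synonym ('a, 'b) chain = "'a \<times> 'b list"

definition chain_verts :: "('a, 'b) pre_digraph \<Rightarrow> ('a, 'b) chain \<Rightarrow> 'a set" where
  "chain_verts M c = set (pre_digraph.awalk_verts M (fst c) (snd c))"

definition is_chain :: "('a, 'b) pre_digraph \<Rightarrow> ('a, 'b) chain \<Rightarrow> bool" where
  "is_chain M c \<longleftrightarrow> (\<exists>v. pre_digraph.apath M (fst c) (snd c) v)"

definition is_pcd :: "('a, 'b) pre_digraph \<Rightarrow> ('a, 'b) chain multiset \<Rightarrow> bool" where
  "is_pcd M C \<longleftrightarrow>
     (\<forall>c \<in># C. is_chain M c) \<and>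
     (\<forall>x \<in> arcs M. size {# c \<in># C. x \<in> set (snd c) #} = 1) \<and>
     (\<forall>a \<in> verts M. size {# c \<in># C. a \<in> chain_verts M c #} = 2)"

definition internal :: "('a, 'b) pre_digraph \<Rightarrow> 'a \<Rightarrow> bool" where
  "internal M a \<longleftrightarrow> a \<in> verts M \<and> 1 \<le> in_degree M a \<and> 1 \<le> out_degree M a"

text \<open>The choice of a decomposition at \<open>a\<close>: which incoming arcs are continued by which
  outgoing arcs.\<close>

definition pcd_choice ::
    "('a, 'b) pre_digraph \<Rightarrow> ('a, 'b) chain multiset \<Rightarrow> 'a \<Rightarrow> ('b \<times> 'b) set" where
  "pcd_choice M C a =
     {(x, y). head M x = a \<and> (\<exists>c \<in># C. (x, y) \<in> set (consecutive (snd c)))}"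

text \<open>As there are exactly two possible choices at an internal vertex, the opposite choice is
  the one that is different.\<close>

definition is_dual_pcd ::
    "('a, 'b) pre_digraph \<Rightarrow> ('a, 'b) chain multiset \<Rightarrow> ('a, 'b) chain multiset \<Rightarrow> bool" where
  "is_dual_pcd M C D \<longleftrightarrow>
     is_pcd M D \<and> (\<forall>a. internal M a \<longrightarrow> pcd_choice M D a \<noteq> pcd_choice M C a)"

definition dual_pcd ::
    "('a, 'b) pre_digraph \<Rightarrow> ('a, 'b) chain multiset \<Rightarrow> ('a, 'b) chain multiset" where
  "dual_pcd M C = (THE D. is_dual_pcd M C D)"

definition leo_chain :: "'v egraph \<Rightarrow> 'v \<Rightarrow> (nat, 'v \<times> nat \<times> nat) chain" where
  "leo_chain G v = (hd (leo G v), map (Pair v) (consecutive (leo G v)))"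

definition leo_pcd :: "'v egraph \<Rightarrow> (nat, 'v \<times> nat \<times> nat) chain multiset" where
  "leo_pcd G = image_mset (leo_chain G) (mset_set {v \<in> everts G. leo G v \<noteq> []})"

definition map_pcd ::
    "('a, 'b, 'c, 'd) digraph_isomorphism \<Rightarrow> ('a, 'b) chain multiset \<Rightarrow> ('c, 'd) chain multiset"
  where
  "map_pcd h C = image_mset (map_prod (iso_verts h) (map (iso_arcs h))) C"

end

theory Submission
  imports Defs
begin

text \<open>
  Write \<open>(e, v)\<close> for the edge \<open>e\<close> traversed towards its end \<open>v\<close>, and call this a dart. The
  greedy rule sends the dart \<open>(e, v)\<close> to \<open>(f, w)\<close>, where \<open>f\<close> is the successor of \<open>e\<close> in the local
  order at \<open>v\<close> and \<open>w\<close> is the other end of \<open>f\<close>. The rule can be reversed: \<open>v\<close> is the other end of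
  \<open>f\<close> as seen from \<open>w\<close>, and \<open>e\<close> is the predecessor of \<open>f\<close> at \<open>v\<close>. Going backwards the labels
  decrease, so every dart lies on exactly one migt (\<open>dart_in_migt\<close>, \<open>dart_migt_unique\<close>). An edge has
  two darts, and these lie on different migts because labels strictly increase along a migt; hence
  the mind-body dual is an e-graph. An arc \<open>e \<rightarrow> f\<close> contributed by the vertex \<open>v\<close> is the same thing
  as the step of the greedy rule from the dart \<open>(e, v)\<close>, which occurs in exactly one migt; this
  makes the canonical identification an isomorphism, and it carries the decomposition induced by the
  dual to a PCD of the medial digraph of the given graph.

  Let \<open>e \<rightarrow> a\<close> be an arc contributed by \<open>v\<close> and \<open>a \<rightarrow> g\<close> one contributed by \<open>w\<close>. The local
  order of the graph continues the first arc by the second exactly if \<open>v = w\<close>. The migt arriving at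
  \<open>v\<close> along \<open>e\<close> next traverses \<open>a\<close>, which takes it to the other end of \<open>a\<close>, so the local order of
  the dual continues the first arc by the second exactly if \<open>v \<noteq> w\<close> (\<open>leo_pcd_choice_iff\<close>,
  \<open>leo_pcd_dual_choice_iff\<close>). An internal vertex has at least one such pair of arcs, so there the two
  choices differ.

  It remains to see that being different determines the dual PCD. The two chains of a PCD through a
  vertex \<open>a\<close> split the incoming arcs into two parts \<open>P, P'\<close> of at most one arc each, and the outgoing
  arcs into \<open>Q, Q'\<close>; the choice is \<open>P \<times> Q \<union> P' \<times> Q'\<close>. Such splittings are unique up to exchanging
  the parts, so the only other possible choice is \<open>P \<times> Q' \<union> P' \<times> Q\<close>, the complement
  (\<open>pcd_choice_opposite\<close>). Finally, the choices determine the PCD: its nontrivial chains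
  are the maximal paths of the relation ``is continued by'', and the number of trivial chains at each
  vertex is what is missing to two (\<open>pcd_eqI_choices\<close>).
\<close>

section \<open>Consecutive entries of a list\<close>

lemma consecutive_simps [simp]:
  "consecutive [] = []"
  "consecutive [x] = []"
  "consecutive (x # y # xs) = (x, y) # consecutive (y # xs)"
  by (simp_all add: consecutive_def)

lemma in_set_consecutive_iff:
  "(x, y) \<in> set (consecutive xs) \<longleftrightarrow> (\<exists>p s. xs = p @ x # y # s)"
proof (induction xs rule: induct_list012)
  case (3 a b zs)
  have "(\<exists>p s. a # b # zs = p @ x # y # s) \<longleftrightarrow>
        a = x \<and> b = y \<or> (\<exists>p s. b # zs = p @ x # y # s)"
  proof (intro iffI; elim exE disjE conjE)
    fix p s assume "a # b # zs = p @ x # y # s"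
    then show "a = x \<and> b = y \<or> (\<exists>p s. b # zs = p @ x # y # s)" by (cases p) auto
  next
    fix p s assume "b # zs = p @ x # y # s"
    then have "a # b # zs = (a # p) @ x # y # s" by simp
    then show "\<exists>p s. a # b # zs = p @ x # y # s" by blast
  next
    assume "a = x" "b = y"
    then have "a # b # zs = [] @ x # y # zs" by simp
    then show "\<exists>p s. a # b # zs = p @ x # y # s" by blast
  qed
  then show ?case using 3 by auto
qed auto

lemma in_set_consecutiveD:
  "(x, y) \<in> set (consecutive xs) \<Longrightarrow> x \<in> set xs \<and> y \<in> set xs"
  by (auto simp: in_set_consecutive_iff)

lemma consecutive_map: "consecutive (map h xs) = map (map_prod h h) (consecutive xs)"
  by (induction xs rule: induct_list012) auto

lemma in_set_consecutive_rev:
  "(x, y) \<in> set (consecutive (rev xs)) \<longleftrightarrow> (y, x) \<in> set (consecutive xs)"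
proof -
  have imp: "(b, a) \<in> set (consecutive (rev zs))" if "(a, b) \<in> set (consecutive zs)"
    for a b :: 'a and zs
  proof -
    from that obtain p s where "zs = p @ a # b # s" by (auto simp: in_set_consecutive_iff)
    then have "rev zs = rev s @ b # a # rev p" by simp
    then show ?thesis unfolding in_set_consecutive_iff by blast
  qed
  show ?thesis using imp[of x y "rev xs"] imp[of y x xs] by auto
qed

lemma in_set_consecutive_distinct_iff:
  assumes "distinct (p @ z # s)"
  shows "(z, y) \<in> set (consecutive (p @ z # s)) \<longleftrightarrow> (\<exists>t. s = y # t)"
proof
  assume "(z, y) \<in> set (consecutive (p @ z # s))"
  then obtain p' s' where eq: "p @ z # s = p' @ z # y # s'"
    by (auto simp: in_set_consecutive_iff)
  with assms have "z \<notin> set p" "z \<notin> set s" "z \<notin> set p'" "z \<notin> set (y # s')"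
    by (auto dest: arg_cong[of _ _ distinct])
  with eq have "s = y # s'" using append_Cons_eq_iff by metis
  then show "\<exists>t. s = y # t" by blast
qed (auto simp: in_set_consecutive_iff)

lemma consecutive_strict_sorted_iff:
  fixes xs :: "nat list"
  assumes "sorted_wrt (<) xs"
  shows "(e, f) \<in> set (consecutive xs) \<longleftrightarrow>
    e \<in> set xs \<and> f \<in> set xs \<and> e < f \<and> (\<forall>g \<in> set xs. g \<le> e \<or> f \<le> g)"
  using assms by (induction xs rule: induct_list012) (auto simp: not_less dest: less_imp_le)

text \<open>Entries of \<open>consecutive (consecutive xs)\<close> are successive pairs of neighbours; this is the form in
  which a list of arcs obtained from \<open>consecutive xs\<close> records which arc continues which. Distinctness
  is what makes two neighbouring pairs that share their middle entry occur next to each other.\<close>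

lemma consecutive_consecutive_iff:
  assumes "distinct xs"
  shows "((d, e), (e', f)) \<in> set (consecutive (consecutive xs)) \<longleftrightarrow>
    e = e' \<and> (d, e) \<in> set (consecutive xs) \<and> (e, f) \<in> set (consecutive xs)"
  using assms
proof (induction xs rule: induct_list012)
  case (3 a b zs)
  show ?case
  proof (cases zs)
    case (Cons c ws)
    then show ?thesis using 3 by (auto dest: in_set_consecutiveD)
  qed (use 3 in simp)
qed auto

text \<open>From a common entry \<open>z\<close> on, both lists can only follow the relation \<open>R\<close>, and each of them stops
  only where \<open>R\<close> does.\<close>

lemma path_extension_unique:
  assumes "distinct (p @ z # s)" "distinct (p' @ z # s')"
    and "\<And>x y. x \<in> set (p @ z # s) \<Longrightarrow> (x, y) \<in> R \<longleftrightarrow> (x, y) \<in> set (consecutive (p @ z # s))"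
    and "\<And>x y. x \<in> set (p' @ z # s') \<Longrightarrow> (x, y) \<in> R \<longleftrightarrow> (x, y) \<in> set (consecutive (p' @ z # s'))"
  shows "s = s'"
  using assms
proof (induction s arbitrary: p p' z s')
  case Nil
  have "(z, y) \<notin> R" for y
    using Nil(3)[of z y] in_set_consecutive_distinct_iff[OF Nil(1), of y] by simp
  then have "\<nexists>t. s' = y # t" for y
    using Nil(4)[of z y] in_set_consecutive_distinct_iff[OF Nil(2), of y] by simp
  then show ?case by (cases s') auto
next
  case (Cons y s)
  have "(z, y) \<in> R"
    using Cons.prems(3)[of z y] in_set_consecutive_distinct_iff[OF Cons.prems(1), of y] by simp
  then obtain t where t: "s' = y # t"
    using Cons.prems(4)[of z y] in_set_consecutive_distinct_iff[OF Cons.prems(2), of y] by auto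
  have "s = t"
    by (rule Cons.IH[of "p @ [z]" y "p' @ [z]"]) (use Cons.prems t in simp_all)
  with t show ?case by simp
qed

text \<open>Each list is closed under \<open>R\<close> in both directions, so after a common entry both agree by
  \<open>path_extension_unique\<close>, and before it by the same lemma for the reversed lists.\<close>

lemma maximal_path_unique:
  assumes "distinct xs" "distinct ys" "z \<in> set xs" "z \<in> set ys"
    and xs: "\<And>x y. x \<in> set xs \<or> y \<in> set xs \<Longrightarrow> (x, y) \<in> R \<longleftrightarrow> (x, y) \<in> set (consecutive xs)"
    and ys: "\<And>x y. x \<in> set ys \<or> y \<in> set ys \<Longrightarrow> (x, y) \<in> R \<longleftrightarrow> (x, y) \<in> set (consecutive ys)"
  shows "xs = ys"
proof -
  obtain p s p' s' where eq: "xs = p @ z # s" "ys = p' @ z # s'"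
    using assms(3,4) by (meson split_list)
  have "s = s'"
    by (rule path_extension_unique[of p z s p' s' R]) (use assms eq in auto)
  moreover have "rev p = rev p'"
  proof (rule path_extension_unique[of "rev s" z "rev p" "rev s'" "rev p'" "R\<inverse>"])
    have rev: "rev s @ z # rev p = rev xs" "rev s' @ z # rev p' = rev ys" using eq by simp_all
    show "distinct (rev s @ z # rev p)" "distinct (rev s' @ z # rev p')"
      unfolding rev using assms by simp_all
    show "(x, y) \<in> R\<inverse> \<longleftrightarrow> (x, y) \<in> set (consecutive (rev s @ z # rev p))"
      if "x \<in> set (rev s @ z # rev p)" for x y
      using that xs[of y x] unfolding rev in_set_consecutive_rev by simp
    show "(x, y) \<in> R\<inverse> \<longleftrightarrow> (x, y) \<in> set (consecutive (rev s' @ z # rev p'))"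
      if "x \<in> set (rev s' @ z # rev p')" for x y
      using that ys[of y x] unfolding rev in_set_consecutive_rev by simp
  qed
  ultimately show ?thesis using eq by simp
qed

section \<open>Perfect chain decompositions and their choices\<close>

text \<open>A chain visits a vertex at most once, so it has at most one arc entering and at most one arc leaving
  a given vertex, and these two are consecutive. In particular, continuation within a chain can be
  read off from heads and tails.\<close>

lemma
  assumes "is_chain M c"
  shows chain_arcs_distinct: "distinct (snd c)"
    and inj_on_head_chain: "inj_on (head M) (set (snd c))"
    and inj_on_tail_chain: "inj_on (tail M) (set (snd c))"
    and chain_arcs_subset: "set (snd c) \<subseteq> arcs M"
    and chain_start_in_verts: "fst c \<in> verts M"
    and head_in_chain_verts: "x \<in> set (snd c) \<Longrightarrow> head M x \<in> chain_verts M c"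
    and tail_in_chain_verts: "x \<in> set (snd c) \<Longrightarrow> tail M x \<in> chain_verts M c"
    and chain_start_eq_tail_hd: "snd c \<noteq> [] \<Longrightarrow> fst c = tail M (hd (snd c))"
    and consecutive_chain_iff: "(x, y) \<in> set (consecutive (snd c)) \<longleftrightarrow>
      x \<in> set (snd c) \<and> y \<in> set (snd c) \<and> head M x = tail M y"
proof -
  interpret pre_digraph M .
  obtain u p where c: "c = (u, p)" by fastforce
  obtain v where "awalk u p v" and dist: "distinct (awalk_verts u p)"
    using assms c by (auto simp: is_chain_def apath_def)
  then have cas: "cas u p v" and sub: "set p \<subseteq> arcs M" "u \<in> verts M"
    by (auto simp: awalk_def)
  have tails: "p \<noteq> [] \<Longrightarrow> awalk_verts u p = map (tail M) p @ [head M (last p)]"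
    and heads: "p \<noteq> [] \<Longrightarrow> awalk_verts u p = tail M (hd p) # map (head M) p"
    using awalk_verts_conv[of u p] awalk_verts_conv'[OF cas] by auto
  from dist tails have dtails: "distinct (map (tail M) p)" by (cases "p = []") auto
  from dist heads have dheads: "distinct (map (head M) p)" by (cases "p = []") auto
  show "distinct (snd c)" "inj_on (head M) (set (snd c))" "inj_on (tail M) (set (snd c))"
    using dtails dheads c by (auto simp: distinct_map)
  show "set (snd c) \<subseteq> arcs M" "fst c \<in> verts M" using sub c by auto
  show "x \<in> set (snd c) \<Longrightarrow> head M x \<in> chain_verts M c"
    using heads c by (cases "p = []") (auto simp: chain_verts_def)
  show "x \<in> set (snd c) \<Longrightarrow> tail M x \<in> chain_verts M c"
    using tails c by (cases "p = []") (auto simp: chain_verts_def)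
  show "snd c \<noteq> [] \<Longrightarrow> fst c = tail M (hd (snd c))"
    using cas c by (cases p) auto
  have "(x, y) \<in> set (consecutive p) \<longleftrightarrow> x \<in> set p \<and> y \<in> set p \<and> head M x = tail M y"
    using cas dist
  proof (induction p arbitrary: u)
    case (Cons z p)
    show ?case
    proof (cases p)
      case Nil
      then show ?thesis using Cons.prems by auto
    next
      case (Cons w q)
      have IH: "(x, y) \<in> set (consecutive p) \<longleftrightarrow> x \<in> set p \<and> y \<in> set p \<and> head M x = tail M y"
        using Cons.IH[of "head M z"] Cons.prems by simp
      have zw: "head M z = tail M w" using Cons.prems(1) \<open>p = w # q\<close> by simp
      have notin: "tail M z \<notin> set (awalk_verts (head M z) p)" using Cons.prems(2) by simp
      have vs: "awalk_verts (head M z) p = map (tail M) p @ [head M (last p)]"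
        "awalk_verts (head M z) p = tail M (hd p) # map (head M) p"
        using awalk_verts_conv[of "head M z" p] awalk_verts_conv'[of "head M z" p v]
          Cons.prems(1) \<open>p = w # q\<close> by auto
      have "distinct (awalk_verts (head M z) p)" using Cons.prems(2) by simp
      then have inj: "distinct (map (tail M) p)" unfolding vs(1) by simp
      have z: "z \<notin> set p" using notin vs(1) by auto
      have no_return: "head M x \<noteq> tail M z" if "x \<in> set (z # p)" for x
        using that notin zw unfolding vs(2) using \<open>p = w # q\<close> by (force simp: image_iff)
      have "tail M w = tail M y \<longleftrightarrow> y = w" if "y \<in> set p"
        using inj that \<open>p = w # q\<close> by (auto simp: distinct_map inj_on_def)
      then show ?thesis
        using IH z zw no_return \<open>p = w # q\<close> by auto
    qed
  qed simp
  then show "(x, y) \<in> set (consecutive (snd c)) \<longleftrightarrow>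
      x \<in> set (snd c) \<and> y \<in> set (snd c) \<and> head M x = tail M y"
    using c by simp
qed

lemma chain_verts_trivial [simp]: "chain_verts M (a, []) = {a}"
  by (simp add: chain_verts_def pre_digraph.awalk_verts.simps)

lemma pcd_chain: "is_pcd M C \<Longrightarrow> c \<in># C \<Longrightarrow> is_chain M c"
  by (simp add: is_pcd_def)

lemma pcd_arc_filter:
  assumes "is_pcd M C" "c \<in># C" "x \<in> set (snd c)"
  shows "filter_mset (\<lambda>c'. x \<in> set (snd c')) C = {#c#}"
proof -
  have "x \<in> arcs M" using chain_arcs_subset[OF pcd_chain[OF assms(1,2)]] assms(3) by blast
  with assms(1) have "size (filter_mset (\<lambda>c'. x \<in> set (snd c')) C) = 1"
    by (auto simp: is_pcd_def)
  then obtain d where d: "filter_mset (\<lambda>c'. x \<in> set (snd c')) C = {#d#}"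
    using size_1_singleton_mset by blast
  moreover have "c \<in># filter_mset (\<lambda>c'. x \<in> set (snd c')) C" using assms by simp
  ultimately show ?thesis by simp
qed

lemma pcd_arc_unique:
  assumes "is_pcd M C" "c \<in># C" "c' \<in># C" "x \<in> set (snd c)" "x \<in> set (snd c')"
  shows "c = c'"
  using pcd_arc_filter[OF assms(1,2,4)] pcd_arc_filter[OF assms(1,3,5)] by simp

lemma pcd_arc_exists:
  assumes "is_pcd M C" "x \<in> arcs M"
  obtains c where "c \<in># C" "x \<in> set (snd c)"
proof -
  have "size (filter_mset (\<lambda>c'. x \<in> set (snd c')) C) = 1"
    using assms by (auto simp: is_pcd_def)
  then obtain d where "filter_mset (\<lambda>c'. x \<in> set (snd c')) C = {#d#}"
    using size_1_singleton_mset by blast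
  then have "d \<in># filter_mset (\<lambda>c'. x \<in> set (snd c')) C" by simp
  then show thesis using that[of d] by simp
qed

text \<open>The two chains through a vertex induce a pair of this kind on the incoming arcs and one on the
  outgoing arcs; a part is empty if the chain starts or ends at the vertex.\<close>

definition splits :: "'a set \<Rightarrow> 'a set \<Rightarrow> 'a set \<Rightarrow> bool" where
  "splits S P Q \<longleftrightarrow> S = P \<union> Q \<and> P \<inter> Q = {} \<and>
     (\<forall>x \<in> P. \<forall>y \<in> P. x = y) \<and> (\<forall>x \<in> Q. \<forall>y \<in> Q. x = y)"

text \<open>Each part has at most one element, and the two together make up \<open>S\<close>. So \<open>P'\<close> is one of \<open>P\<close> and \<open>Q\<close>, and
  the second part is the complement of the first.\<close>

lemma splits_cases:
  assumes "splits S P Q" "splits S P' Q'"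
  shows "P' = P \<and> Q' = Q \<or> P' = Q \<and> Q' = P"
proof -
  have S: "S = P \<union> Q" "S = P' \<union> Q'" "P \<inter> Q = {}" "P' \<inter> Q' = {}"
    and single: "\<forall>x \<in> P. \<forall>y \<in> P. x = y" "\<forall>x \<in> Q. \<forall>y \<in> Q. x = y"
      "\<forall>x \<in> P'. \<forall>y \<in> P'. x = y" "\<forall>x \<in> Q'. \<forall>y \<in> Q'. x = y"
    using assms by (simp_all add: splits_def)
  then have compl: "Q = S - P" "P = S - Q" "Q' = S - P'" and union: "P' \<union> Q' = P \<union> Q"
    by auto
  have "P' = P \<or> P' = Q"
  proof (cases "P = {} \<or> Q = {}")
    case True
    have "P' = {} \<or> P' = P \<union> Q"
    proof (cases "P' = {}")
      case False
      then obtain x where "x \<in> P'" by blast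
      with union have "x \<in> P \<or> x \<in> Q" by auto
      with True single(1,2) have "P \<union> Q \<subseteq> {x}" by auto
      with \<open>x \<in> P'\<close> union show ?thesis by auto
    qed simp
    with True show ?thesis by auto
  next
    case False
    then obtain x y where "x \<in> P" "y \<in> Q" by blast
    then have PQ: "P = {x}" "Q = {y}" using single(1,2) by auto
    with S(3) have "x \<noteq> y" by auto
    have "x \<in> P' \<union> Q'" "y \<in> P' \<union> Q'" unfolding union PQ by auto
    with single(4) \<open>x \<noteq> y\<close> have "x \<in> P' \<or> y \<in> P'" by auto
    with single(3) have "P' = {x} \<or> P' = {y}" by auto
    with PQ show ?thesis by auto
  qed
  with compl show ?thesis by auto
qed

lemma finite_splits: "splits S P Q \<Longrightarrow> finite S"
proof -
  have sub: "finite X" if "\<forall>x \<in> X. \<forall>y \<in> X. x = y" for X :: "'a set"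
  proof (cases "X = {}")
    case False
    then obtain x where "x \<in> X" by blast
    with that have "X = {x}" by blast
    then show ?thesis by simp
  qed simp
  show "splits S P Q \<Longrightarrow> finite S" unfolding splits_def using sub by auto
qed

text \<open>The parts belong to the two chains through \<open>a\<close>: an incoming arc is continued by an outgoing one
  exactly if both lie on the same chain.\<close>

lemma pcd_choice_splits:
  assumes "is_pcd M C" "a \<in> verts M"
  obtains P P' Q Q' where "splits (in_arcs M a) P P'" "splits (out_arcs M a) Q Q'"
    "pcd_choice M C a = P \<times> Q \<union> P' \<times> Q'"
proof -
  let ?F = "filter_mset (\<lambda>c. a \<in> chain_verts M c) C"
  have "size ?F = 2" using assms by (auto simp: is_pcd_def)
  then obtain c N where N: "?F = add_mset c N" "size N = 1"
    by (metis One_nat_def Suc_1 add_diff_cancel_left' plus_1_eq_Suc size_add_mset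
        size_eq_Suc_imp_eq_union)
  then obtain c' where F: "?F = {#c, c'#}" using size_1_singleton_mset[OF N(2)] by blast
  have mem: "d \<in># C \<and> a \<in> chain_verts M d \<longleftrightarrow> d = c \<or> d = c'" for d
  proof -
    have "d \<in># C \<and> a \<in> chain_verts M d \<longleftrightarrow> d \<in># ?F" by simp
    also have "\<dots> \<longleftrightarrow> d = c \<or> d = c'" unfolding F by auto
    finally show ?thesis .
  qed
  have cC: "c \<in># C" "c' \<in># C" using mem by blast+
  note ch = pcd_chain[OF assms(1) cC(1)] pcd_chain[OF assms(1) cC(2)]
  \<comment> \<open>The two chains may be equal as chains, but only if they are trivial.\<close>
  have disj: "set (snd c) \<inter> set (snd c') = {}"
  proof (rule ccontr)
    assume "set (snd c) \<inter> set (snd c') \<noteq> {}"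
    then obtain x where x: "x \<in> set (snd c)" "x \<in> set (snd c')" by blast
    have "filter_mset (\<lambda>c'. x \<in> set (snd c')) ?F \<subseteq># filter_mset (\<lambda>c'. x \<in> set (snd c')) C"
      by (simp add: multiset_filter_mono)
    also have "\<dots> = {#c#}" by (rule pcd_arc_filter[OF assms(1) cC(1) x(1)])
    finally show False unfolding F using x by (auto dest: size_mset_mono)
  qed
  define P where "P d = {x \<in> set (snd d). head M x = a}" for d :: "'a \<times> 'b list"
  define Q where "Q d = {x \<in> set (snd d). tail M x = a}" for d :: "'a \<times> 'b list"
  have cover: "d = c \<or> d = c'" if "d \<in># C" "x \<in> set (snd d)" "head M x = a \<or> tail M x = a" for d x
  proof -
    have "a \<in> chain_verts M d"
      using that(3) head_in_chain_verts[OF pcd_chain[OF assms(1) that(1)] that(2)]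
        tail_in_chain_verts[OF pcd_chain[OF assms(1) that(1)] that(2)] by auto
    with mem that(1) show ?thesis by blast
  qed
  have arcs: "set (snd c) \<subseteq> arcs M" "set (snd c') \<subseteq> arcs M" using ch chain_arcs_subset by blast+
  have "in_arcs M a = P c \<union> P c'"
  proof (intro equalityI subsetI)
    fix x assume "x \<in> in_arcs M a"
    then have x: "x \<in> arcs M" "head M x = a" by (auto simp: in_arcs_def)
    obtain d where d: "d \<in># C" "x \<in> set (snd d)" using pcd_arc_exists[OF assms(1) x(1)] .
    with cover[OF d] x show "x \<in> P c \<union> P c'" by (auto simp: P_def)
  qed (use arcs in \<open>auto simp: P_def in_arcs_def\<close>)
  then have 1: "splits (in_arcs M a) (P c) (P c')"
    using disj inj_on_head_chain[OF ch(1)] inj_on_head_chain[OF ch(2)]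
    unfolding splits_def by (auto simp: P_def inj_on_def)
  have "out_arcs M a = Q c \<union> Q c'"
  proof (intro equalityI subsetI)
    fix x assume "x \<in> out_arcs M a"
    then have x: "x \<in> arcs M" "tail M x = a" by (auto simp: out_arcs_def)
    obtain d where d: "d \<in># C" "x \<in> set (snd d)" using pcd_arc_exists[OF assms(1) x(1)] .
    with cover[OF d] x show "x \<in> Q c \<union> Q c'" by (auto simp: Q_def)
  qed (use arcs in \<open>auto simp: Q_def out_arcs_def\<close>)
  then have 2: "splits (out_arcs M a) (Q c) (Q c')"
    using disj inj_on_tail_chain[OF ch(1)] inj_on_tail_chain[OF ch(2)]
    unfolding splits_def by (auto simp: Q_def inj_on_def)
  have "pcd_choice M C a = P c \<times> Q c \<union> P c' \<times> Q c'"
  proof (intro equalityI subsetI)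
    fix z assume "z \<in> pcd_choice M C a"
    then obtain x y d where z: "z = (x, y)" "head M x = a" "d \<in># C"
      "(x, y) \<in> set (consecutive (snd d))"
      by (auto simp: pcd_choice_def)
    with consecutive_chain_iff[OF pcd_chain[OF assms(1) z(3)]] have
      "x \<in> set (snd d)" "y \<in> set (snd d)" "tail M y = a" by auto
    with cover[OF z(3), of x] z show "z \<in> P c \<times> Q c \<union> P c' \<times> Q c'" by (auto simp: P_def Q_def)
  next
    fix z assume "z \<in> P c \<times> Q c \<union> P c' \<times> Q c'"
    then obtain x y d where z: "z = (x, y)" "d \<in># C" "x \<in> P d" "y \<in> Q d" using cC by blast
    then have "(x, y) \<in> set (consecutive (snd d))" "head M x = a"
      using consecutive_chain_iff[OF pcd_chain[OF assms(1) z(2)]] by (auto simp: P_def Q_def)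
    with z(1,2) show "z \<in> pcd_choice M C a" unfolding pcd_choice_def by blast
  qed
  with 1 2 that show thesis by blast
qed

text \<open>There are only two ways to match the two parts of the incoming arcs with the two parts of the
  outgoing arcs, and together they exhaust all pairs.\<close>

lemma pcd_choice_opposite:
  assumes "is_pcd M C" "is_pcd M D" "a \<in> verts M" "pcd_choice M D a \<noteq> pcd_choice M C a"
  shows "pcd_choice M D a = in_arcs M a \<times> out_arcs M a - pcd_choice M C a"
proof -
  obtain P P' Q Q' where C: "splits (in_arcs M a) P P'" "splits (out_arcs M a) Q Q'"
    "pcd_choice M C a = P \<times> Q \<union> P' \<times> Q'"
    using pcd_choice_splits[OF assms(1,3)] .
  obtain R R' S S' where D: "splits (in_arcs M a) R R'" "splits (out_arcs M a) S S'"
    "pcd_choice M D a = R \<times> S \<union> R' \<times> S'"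
    using pcd_choice_splits[OF assms(2,3)] .
  have "R \<times> S \<union> R' \<times> S' = P \<times> Q \<union> P' \<times> Q' \<or> R \<times> S \<union> R' \<times> S' = P \<times> Q' \<union> P' \<times> Q"
    using splits_cases[OF C(1) D(1)] splits_cases[OF C(2) D(2)] by auto
  then have "pcd_choice M D a = P \<times> Q' \<union> P' \<times> Q"
    using assms(4) unfolding C(3) D(3) by simp
  moreover have "P \<inter> P' = {}" "Q \<inter> Q' = {}" using C(1,2) by (simp_all add: splits_def)
  then have "P \<times> Q' \<union> P' \<times> Q = (P \<union> P') \<times> (Q \<union> Q') - (P \<times> Q \<union> P' \<times> Q')"
    by auto
  ultimately show ?thesis using C by (simp add: splits_def)
qed

lemma pcd_choice_not_internal:
  assumes "is_pcd M C" "a \<in> verts M" "\<not> internal M a"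
  shows "pcd_choice M C a = {}"
proof -
  obtain P P' Q Q' where C: "splits (in_arcs M a) P P'" "splits (out_arcs M a) Q Q'"
    "pcd_choice M C a = P \<times> Q \<union> P' \<times> Q'"
    using pcd_choice_splits[OF assms(1,2)] .
  have "card (in_arcs M a) = 0 \<or> card (out_arcs M a) = 0"
    using assms(2,3) by (auto simp: internal_def in_degree_def out_degree_def)
  then have "in_arcs M a = {} \<or> out_arcs M a = {}"
    using finite_splits[OF C(1)] finite_splits[OF C(2)] by simp
  with C show ?thesis by (auto simp: splits_def)
qed

text \<open>The choices of a PCD, taken together, form the relation of being continued by, and each chain is a
  maximal path of this relation; so it is determined by any of its arcs.\<close>

lemma pcd_chain_transfer:
  assumes "wf_digraph M" "is_pcd M C" "is_pcd M D"
    and choices: "\<And>a. a \<in> verts M \<Longrightarrow> pcd_choice M C a = pcd_choice M D a"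
    and c: "c \<in># C" "snd c \<noteq> []"
  shows "c \<in># D"
proof -
  interpret wf_digraph M by fact
  define R where "R E = (\<Union>a \<in> verts M. pcd_choice M E a)" for E
  have R: "(x, y) \<in> R E \<longleftrightarrow> (x, y) \<in> set (consecutive (snd d))"
    if E: "is_pcd M E" "d \<in># E" "x \<in> set (snd d) \<or> y \<in> set (snd d)" for E d x y
  proof
    assume "(x, y) \<in> R E"
    then obtain d' where d': "d' \<in># E" "(x, y) \<in> set (consecutive (snd d'))"
      by (auto simp: R_def pcd_choice_def)
    then have "d' = d" using pcd_arc_unique[OF E(1) d'(1) E(2)] E(3) in_set_consecutiveD by metis
    with d' show "(x, y) \<in> set (consecutive (snd d))" by simp
  next
    assume xy: "(x, y) \<in> set (consecutive (snd d))"
    then have "x \<in> arcs M"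
      using in_set_consecutiveD[OF xy] chain_arcs_subset[OF pcd_chain[OF E(1,2)]] by blast
    then have "head M x \<in> verts M" by simp
    with xy E(2) show "(x, y) \<in> R E" by (auto simp: R_def pcd_choice_def)
  qed
  have "R C = R D" using choices by (simp add: R_def)
  define z where "z = hd (snd c)"
  have z: "z \<in> set (snd c)" using c by (simp add: z_def)
  then have "z \<in> arcs M" using chain_arcs_subset[OF pcd_chain[OF assms(2) c(1)]] by blast
  then obtain d where d: "d \<in># D" "z \<in> set (snd d)" using pcd_arc_exists[OF assms(3)] by blast
  note chains = pcd_chain[OF assms(2) c(1)] pcd_chain[OF assms(3) d(1)]
  have "snd c = snd d"
  proof (rule maximal_path_unique[of _ _ z "R C"])
    show "distinct (snd c)" "distinct (snd d)" using chain_arcs_distinct chains by blast+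
    show "(x, y) \<in> R C \<longleftrightarrow> (x, y) \<in> set (consecutive (snd c))"
      if "x \<in> set (snd c) \<or> y \<in> set (snd c)" for x y
      using R[OF assms(2) c(1) that] .
    show "(x, y) \<in> R C \<longleftrightarrow> (x, y) \<in> set (consecutive (snd d))"
      if "x \<in> set (snd d) \<or> y \<in> set (snd d)" for x y
      using R[OF assms(3) d(1) that] \<open>R C = R D\<close> by simp
  qed (use z d in auto)
  moreover have "fst c = fst d"
    using chain_start_eq_tail_hd[OF chains(1)] chain_start_eq_tail_hd[OF chains(2)] c(2) calculation by simp
  ultimately show ?thesis using d(1) by (metis prod_eqI)
qed

text \<open>The choices see the nontrivial chains only, each of which has multiplicity one. The multiplicity of
  a trivial chain is then forced, since every vertex lies on exactly two chains.\<close>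

lemma pcd_eqI_choices:
  assumes "wf_digraph M" "is_pcd M C" "is_pcd M D"
    and choices: "\<And>a. a \<in> verts M \<Longrightarrow> pcd_choice M C a = pcd_choice M D a"
  shows "C = D"
proof -
  have count_nontrivial: "count E c = (if c \<in># E then 1 else 0)"
    if "is_pcd M E" "snd c \<noteq> []" for E c
  proof (cases "c \<in># E")
    case True
    have "hd (snd c) \<in> set (snd c)" using that by simp
    from pcd_arc_filter[OF that(1) True this]
    have "count (filter_mset (\<lambda>c'. hd (snd c) \<in> set (snd c')) E) c = 1" by simp
    with True that(2) show ?thesis by simp
  qed (simp add: not_in_iff)
  have nontrivial: "count C c = count D c" if "snd c \<noteq> []" for c
  proof -
    have "c \<in># C \<longleftrightarrow> c \<in># D"
      using pcd_chain_transfer[OF assms(1-3) choices _ that]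
        pcd_chain_transfer[OF assms(1,3,2) choices[symmetric] _ that] by blast
    then show ?thesis
      using count_nontrivial[OF assms(2) that] count_nontrivial[OF assms(3) that] by simp
  qed
  let ?N = "\<lambda>a E. filter_mset (\<lambda>c. snd c \<noteq> [] \<and> a \<in> chain_verts M c) E"
  have count_trivial: "count E (a, []) + size (?N a E) = 2" if "is_pcd M E" "a \<in> verts M" for E a
  proof -
    have "filter_mset (\<lambda>c. a \<in> chain_verts M c) E =
      filter_mset (\<lambda>c. c = (a, [])) E + ?N a E"
    proof (rule multiset_eqI)
      fix c :: "'a \<times> 'b list"
      show "count (filter_mset (\<lambda>c. a \<in> chain_verts M c) E) c =
        count (filter_mset (\<lambda>c. c = (a, [])) E + ?N a E) c"
        by (cases c; cases "snd c = []") auto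
    qed
    then have "size (filter_mset (\<lambda>c. a \<in> chain_verts M c) E) =
        count E (a, []) + size (?N a E)"
      by (simp add: filter_eq_replicate_mset)
    with that show ?thesis by (auto simp: is_pcd_def)
  qed
  show ?thesis
  proof (rule multiset_eqI)
    fix c
    show "count C c = count D c"
    proof (cases "snd c = []")
      case True
      then obtain a where c: "c = (a, [])" by (cases c) auto
      show ?thesis
      proof (cases "a \<in> verts M")
        case True
        have "?N a C = ?N a D" by (rule multiset_eqI) (simp add: nontrivial)
        with count_trivial[OF assms(2) True] count_trivial[OF assms(3) True] c
        show ?thesis by simp
      next
        case False
        then have "c \<notin># C" "c \<notin># D"
          using chain_start_in_verts pcd_chain[OF assms(2)] pcd_chain[OF assms(3)] c
          by (metis fst_conv)+
        then show ?thesis by (simp add: not_in_iff)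
      qed
    qed (rule nontrivial)
  qed
qed

lemma dual_pcd_eqI:
  assumes "wf_digraph M" "is_pcd M C" "is_dual_pcd M C D"
  shows "dual_pcd M C = D"
  unfolding dual_pcd_def
proof (rule the_equality, rule assms(3))
  fix E assume E: "is_dual_pcd M C E"
  show "E = D"
  proof (rule pcd_eqI_choices[OF assms(1)])
    show pcds: "is_pcd M E" "is_pcd M D" using E assms(3) by (auto simp: is_dual_pcd_def)
    fix a assume a: "a \<in> verts M"
    show "pcd_choice M E a = pcd_choice M D a"
    proof (cases "internal M a")
      case True
      then have "pcd_choice M E a \<noteq> pcd_choice M C a" "pcd_choice M D a \<noteq> pcd_choice M C a"
        using E assms(3) by (auto simp: is_dual_pcd_def)
      then show ?thesis
        using pcd_choice_opposite[OF assms(2) _ a] pcds by metis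
    qed (use pcd_choice_not_internal pcds a in metis)
  qed
qed

lemma is_pcd_map_pcd:
  assumes "wf_digraph M" "pre_digraph.digraph_isomorphism M h" "is_pcd M C"
  shows "is_pcd (app_iso h M) (map_pcd h C)"
proof -
  interpret wf_digraph M by fact
  have inj: "inj_on (iso_arcs h) (arcs M)" "inj_on (iso_verts h) (verts M)"
    using assms(2) by (auto simp: digraph_isomorphism_def)
  let ?f = "map_prod (iso_verts h) (map (iso_arcs h))"
  have sub: "set (snd c) \<subseteq> arcs M" if "c \<in># C" for c
    using chain_arcs_subset[OF pcd_chain[OF assms(3) that]] .
  have walk: "\<exists>v. apath (fst c) (snd c) v" if "c \<in># C" for c
    using pcd_chain[OF assms(3) that] by (simp add: is_chain_def)
  have verts: "chain_verts (app_iso h M) (?f c) = iso_verts h ` chain_verts M c"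
    and vsub: "chain_verts M c \<subseteq> verts M" if c: "c \<in># C" for c
  proof -
    from walk[OF c] obtain v where v: "awalk (fst c) (snd c) v" by (auto simp: apath_def)
    show "chain_verts (app_iso h M) (?f c) = iso_verts h ` chain_verts M c"
      using awalk_verts_app_iso_eq[OF assms(2) v] by (simp add: chain_verts_def)
    show "chain_verts M c \<subseteq> verts M" using v by (auto simp: chain_verts_def)
  qed
  show ?thesis unfolding is_pcd_def
  proof (intro conjI ballI)
    fix d assume "d \<in># map_pcd h C"
    then obtain c where c: "c \<in># C" "d = ?f c" by (auto simp: map_pcd_def)
    from walk[OF c(1)] obtain v where v: "awalk (fst c) (snd c) v"
      "distinct (awalk_verts (fst c) (snd c))" by (auto simp: apath_def)
    have "inj_on (iso_verts h) (set (awalk_verts (fst c) (snd c)))"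
      using inj(2) vsub[OF c(1)] inj_on_subset by (auto simp: chain_verts_def)
    then show "is_chain (app_iso h M) d"
      using awalk_app_isoI[OF v(1) assms(2)] awalk_verts_app_iso_eq[OF assms(2) v(1)] v(2)
      unfolding is_chain_def pre_digraph.apath_def c(2) by (auto simp: distinct_map)
  next
    fix x' assume "x' \<in> arcs (app_iso h M)"
    then obtain x where x: "x \<in> arcs M" "x' = iso_arcs h x" by auto
    have "x' \<in> set (snd (?f c)) \<longleftrightarrow> x \<in> set (snd c)" if "c \<in># C" for c
      using inj_on_image_mem_iff[OF inj(1) x(1) sub[OF that]] x by simp
    then have "filter_mset (\<lambda>c. x' \<in> set (snd (?f c))) C = filter_mset (\<lambda>c. x \<in> set (snd c)) C"
      by (intro filter_mset_cong) auto
    then show "size (filter_mset (\<lambda>c. x' \<in> set (snd c)) (map_pcd h C)) = 1"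
      using assms(3) x(1) unfolding map_pcd_def filter_mset_image_mset
      by (auto simp: is_pcd_def)
  next
    fix a' assume "a' \<in> verts (app_iso h M)"
    then obtain a where a: "a \<in> verts M" "a' = iso_verts h a" by auto
    have "a' \<in> chain_verts (app_iso h M) (?f c) \<longleftrightarrow> a \<in> chain_verts M c" if "c \<in># C" for c
      using inj_on_image_mem_iff[OF inj(2) a(1) vsub[OF that]] a verts[OF that] by simp
    then have "filter_mset (\<lambda>c. a' \<in> chain_verts (app_iso h M) (?f c)) C =
        filter_mset (\<lambda>c. a \<in> chain_verts M c) C"
      by (intro filter_mset_cong) auto
    then show "size (filter_mset (\<lambda>c. a' \<in> chain_verts (app_iso h M) c) (map_pcd h C)) = 2"
      using assms(3) a(1) unfolding map_pcd_def filter_mset_image_mset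
      by (auto simp: is_pcd_def)
  qed
qed

section \<open>The local edge order\<close>

lemma other_end:
  assumes "is_egraph G" "i \<in> eedges G" "v \<in> ends G i"
  shows "ends G i = {v, other_end G i v}" "other_end G i v \<noteq> v"
    "other_end G i (other_end G i v) = v"
proof -
  have card: "card (ends G i) = 2" using assms by (auto simp: is_egraph_def)
  then obtain x y where "ends G i = {x, y}" "x \<noteq> y" by (auto simp: card_2_iff)
  with assms(3) obtain u where u: "ends G i = {v, u}" "u \<noteq> v" by fastforce
  then have "ends G i - {v} = {u}" "ends G i - {u} = {v}" by auto
  then have "other_end G i v = u" "other_end G i u = v" by (simp_all add: other_end_def)
  with u show "ends G i = {v, other_end G i v}" "other_end G i v \<noteq> v"
    "other_end G i (other_end G i v) = v" by simp_all
qed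

lemma set_leo [simp]: "set (leo G v) = {i \<in> eedges G. v \<in> ends G i}"
  unfolding leo_def by (subst set_sorted_list_of_set) (auto simp: eedges_def)

lemma leo_sorted: "sorted_wrt (<) (leo G v)"
  by (simp add: leo_def)

lemma leo_distinct: "distinct (leo G v)"
  by (simp add: leo_def)

lemma eedges_pos: "i \<in> eedges G \<Longrightarrow> 0 < i"
  by (simp add: eedges_def)

section \<open>Darts and migts\<close>

text \<open>A dart \<open>(e, v)\<close> is the edge \<open>e\<close> traversed towards \<open>v\<close>. As labels are positive, the pair \<open>(0, v)\<close>
  can play the part of a dart preceding the first step of the migt of \<open>v\<close>.\<close>

definition next_dart :: "'v egraph \<Rightarrow> nat \<times> 'v \<Rightarrow> nat \<times> 'v \<Rightarrow> bool" where
  "next_dart G d d' \<longleftrightarrow> fst d' \<in> set (leo G (snd d)) \<and> fst d < fst d' \<and>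
     (\<forall>g \<in> set (leo G (snd d)). g \<le> fst d \<or> fst d' \<le> g) \<and>
     snd d' = other_end G (fst d') (snd d)"

lemma next_dart_unique: "next_dart G d d1 \<Longrightarrow> next_dart G d d2 \<Longrightarrow> d1 = d2"
  unfolding next_dart_def by (intro prod_eqI) (force simp: not_le)+

text \<open>The recursion of a migt in terms of \<open>next_dart\<close>, so that later arguments need not mention the
  filtered local order.\<close>

lemma migt_steps_cases:
  obtains "migt_steps G v e = []" "\<And>d. \<not> next_dart G (e, v) d"
  | f w where "migt_steps G v e = (f, w) # migt_steps G w f" "next_dart G (e, v) (f, w)"
proof (cases "filter (\<lambda>f. e < f) (leo G v)")
  case Nil
  then have "migt_steps G v e = []" by (simp add: migt_steps.simps)
  moreover have "\<not> next_dart G (e, v) d" for d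
    using Nil unfolding next_dart_def by (auto simp: filter_empty_conv)
  ultimately show thesis by (rule that(1))
next
  case (Cons f fs)
  have steps: "migt_steps G v e = (f, other_end G f v) # migt_steps G (other_end G f v) f"
    by (subst migt_steps.simps) (simp add: Cons)
  have sorted: "sorted_wrt (<) (f # fs)"
    using sorted_wrt_filter[OF leo_sorted, of "\<lambda>f. e < f" G v] Cons by simp
  have mem: "g \<in> set (leo G v) \<and> e < g \<longleftrightarrow> g = f \<or> g \<in> set fs" for g
    using arg_cong[OF Cons, of set] by auto
  have f: "f \<in> set (leo G v)" "e < f" using mem[of f] by blast+
  have min: "g \<le> e \<or> f \<le> g" if "g \<in> set (leo G v)" for g
  proof (cases "e < g")
    case True
    with that mem[of g] have "g = f \<or> g \<in> set fs" by blast
    with sorted show ?thesis by auto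
  qed simp
  have "next_dart G (e, v) (f, other_end G f v)"
    unfolding next_dart_def fst_conv snd_conv using f min by blast
  with steps show thesis by (rule that(2))
qed

lemma migt_steps_induct [case_names Nil Cons]:
  assumes "\<And>v e. migt_steps G v e = [] \<Longrightarrow> (\<And>d. \<not> next_dart G (e, v) d) \<Longrightarrow> P v e"
    and "\<And>v e f w. migt_steps G v e = (f, w) # migt_steps G w f \<Longrightarrow>
      next_dart G (e, v) (f, w) \<Longrightarrow> P w f \<Longrightarrow> P v e"
  shows "P v e"
proof (induction "esize G - e" arbitrary: v e rule: less_induct)
  case less
  show ?case
  proof (cases rule: migt_steps_cases[of G v e])
    case 1
    then show ?thesis using assms(1) by blast
  next
    case (2 f w)
    then have "e < f" "f \<le> esize G" by (auto simp: next_dart_def eedges_def)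
    then have "P w f" by (intro less) simp
    with 2 assms(2) show ?thesis by blast
  qed
qed

lemma migt_steps_greater: "d \<in> set (migt_steps G v e) \<Longrightarrow> e < fst d"
  by (induction v e rule: migt_steps_induct[of G]) (force simp: next_dart_def)+

lemma migt_steps_sorted: "sorted_wrt (<) (map fst (migt_steps G v e))"
  by (induction v e rule: migt_steps_induct[of G]) (auto dest: migt_steps_greater)

lemma migt_steps_distinct: "distinct (map fst (migt_steps G v e))" "distinct (migt_steps G v e)"
  using migt_steps_sorted[of G v e] strict_sorted_iff distinct_map by blast+

lemma migt_steps_unique_arrival:
  "(i, w) \<in> set (migt_steps G v e) \<Longrightarrow> (i, w') \<in> set (migt_steps G v e) \<Longrightarrow> w = w'"
  using migt_steps_distinct(1)[of G v e] eq_key_imp_eq_value by metis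

lemma migt_steps_next:
  "d \<in> insert (e, v) (set (migt_steps G v e)) \<Longrightarrow> next_dart G d d' \<Longrightarrow>
    d' \<in> set (migt_steps G v e)"
proof (induction v e rule: migt_steps_induct[of G])
  case (Cons v e f w)
  then show ?case using next_dart_unique[of G "(e, v)" "(f, w)" d'] by auto
qed auto

lemma migt_steps_pred:
  "d' \<in> set (migt_steps G v e) \<Longrightarrow> \<exists>d \<in> insert (e, v) (set (migt_steps G v e)). next_dart G d d'"
  by (induction v e rule: migt_steps_induct[of G]) auto

text \<open>A migt does not only follow \<open>next_dart\<close>; it also never stops at a dart that has a successor.\<close>

lemma consecutive_migt_steps_iff:
  "(d, d') \<in> set (consecutive (migt_steps G v e)) \<longleftrightarrow>
    d \<in> set (migt_steps G v e) \<and> next_dart G d d'"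
proof (induction v e rule: migt_steps_induct[of G])
  case (Cons v e f w)
  show ?case
  proof (cases rule: migt_steps_cases[of G w f])
    case 1
    then show ?thesis using Cons by simp
  next
    case (2 g u)
    have "(d, d') \<in> set (consecutive (migt_steps G v e)) \<longleftrightarrow>
        d = (f, w) \<and> d' = (g, u) \<or> (d, d') \<in> set (consecutive (migt_steps G w f))"
      unfolding Cons(1) by (subst (1 2) 2(1)) simp
    moreover have "d' = (g, u) \<longleftrightarrow> next_dart G (f, w) d'"
      using next_dart_unique[OF 2(2)] 2(2) by metis
    moreover have "set (migt_steps G v e) = insert (f, w) (set (migt_steps G w f))"
      unfolding Cons(1) by simp
    ultimately show ?thesis using Cons(3) by (metis insert_iff)
  qed
qed simp

lemma migt_steps_dart:
  assumes "is_egraph G" "(i, w) \<in> set (migt_steps G v e)"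
  shows "i \<in> eedges G" "w \<in> ends G i"
proof -
  obtain d where d: "next_dart G d (i, w)" using migt_steps_pred[OF assms(2)] by blast
  then show "i \<in> eedges G" by (auto simp: next_dart_def)
  have "snd d \<in> ends G i" "w = other_end G i (snd d)" using d by (auto simp: next_dart_def)
  with other_end(1)[OF assms(1) \<open>i \<in> eedges G\<close>] show "w \<in> ends G i" by blast
qed

text \<open>The greedy rule is reversible: the last dart tells the end of its edge at which the trail was
  before, and \<open>e\<close> is the largest label at this end below that of the edge. The start \<open>(0, u)\<close> is
  the case in which there is no smaller label.\<close>

lemma prev_dart_unique:
  assumes "is_egraph G" "next_dart G (e, u) d" "next_dart G (e', u') d"
    and "e = 0 \<or> e \<in> set (leo G u)" "e' = 0 \<or> e' \<in> set (leo G u')"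
  shows "(e, u) = (e', u')"
proof -
  have "fst d \<in> eedges G" "u \<in> ends G (fst d)" "u' \<in> ends G (fst d)"
    "other_end G (fst d) u = other_end G (fst d) u'"
    using assms(2,3) by (auto simp: next_dart_def)
  then have "u = u'" using other_end(3)[OF assms(1)] by metis
  moreover have "e = e'"
    using assms(2-5) unfolding \<open>u = u'\<close> next_dart_def fst_conv snd_conv
    by (metis le_antisym le_zero_eq linorder_not_le nat_le_linear)
  ultimately show ?thesis by simp
qed

lemma prev_dart_exists:
  assumes "is_egraph G" "i \<in> eedges G" "w \<in> ends G i"
  obtains e u where "next_dart G (e, u) (i, w)" "e = 0 \<or> e \<in> set (leo G u)" "u \<in> everts G"
proof -
  define u where "u = other_end G i w"
  have u: "u \<in> ends G i" "other_end G i u = w"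
    using other_end[OF assms] by (auto simp: u_def)
  \<comment> \<open>The value \<open>0\<close> is taken if \<open>i\<close> is the smallest label at \<open>u\<close>; the migt of \<open>u\<close> then starts with \<open>i\<close>.\<close>
  let ?E = "insert 0 {e \<in> set (leo G u). e < i}"
  have fin: "finite ?E" by simp
  define e where "e = Max ?E"
  have e: "e \<in> ?E" unfolding e_def by (rule Max_in[OF fin]) simp
  have "e < i" using e eedges_pos[OF assms(2)] by auto
  moreover have "g \<le> e \<or> i \<le> g" if "g \<in> set (leo G u)" for g
    using Max_ge[OF fin, of g] that by (auto simp: e_def not_le)
  ultimately have "next_dart G (e, u) (i, w)"
    using u assms(2) by (simp add: next_dart_def)
  moreover have "e = 0 \<or> e \<in> set (leo G u)" using e by auto
  moreover have "u \<in> everts G" using assms(1,2) u(1) by (auto simp: is_egraph_def)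
  ultimately show thesis by (rule that)
qed

text \<open>Trace the dart back by \<open>next_dart\<close>. Labels decrease, so this ends at some \<open>(0, v)\<close>.\<close>

lemma dart_in_migt:
  assumes "is_egraph G" "i \<in> eedges G" "w \<in> ends G i"
  shows "\<exists>v \<in> everts G. (i, w) \<in> set (migt_steps G v 0)"
  using assms(2,3)
proof (induction i arbitrary: w rule: less_induct)
  case (less i)
  obtain e u where eu: "next_dart G (e, u) (i, w)" "e = 0 \<or> e \<in> set (leo G u)" "u \<in> everts G"
    using prev_dart_exists[OF assms(1) less.prems] .
  show ?case
  proof (cases "e = 0")
    case True
    then show ?thesis using eu migt_steps_next[of "(e, u)" 0 u G] by auto
  next
    case False
    moreover have "e < i" using eu(1) by (simp add: next_dart_def)
    ultimately obtain v where v: "v \<in> everts G" "(e, u) \<in> set (migt_steps G v 0)"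
      using less.IH[of e u] eu(2) by auto
    then show ?thesis using migt_steps_next[OF _ eu(1), of 0 v] by auto
  qed
qed

text \<open>Tracing the dart back along either trail gives the same predecessors, hence the same start.\<close>

lemma dart_migt_unique:
  assumes "is_egraph G" "(i, w) \<in> set (migt_steps G v 0)" "(i, w) \<in> set (migt_steps G v' 0)"
  shows "v = v'"
  using assms(2,3)
proof (induction i arbitrary: w rule: less_induct)
  case (less i)
  obtain e u where eu: "(e, u) \<in> insert (0, v) (set (migt_steps G v 0))"
    "next_dart G (e, u) (i, w)"
    using migt_steps_pred[OF less.prems(1)] by auto
  obtain e' u' where eu': "(e', u') \<in> insert (0, v') (set (migt_steps G v' 0))"
    "next_dart G (e', u') (i, w)"
    using migt_steps_pred[OF less.prems(2)] by auto
  have "e = 0 \<or> e \<in> set (leo G u)" "e' = 0 \<or> e' \<in> set (leo G u')"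
    using eu(1) eu'(1) migt_steps_dart[OF assms(1)] by auto
  then have same: "e' = e" "u' = u" using prev_dart_unique[OF assms(1) eu(2) eu'(2)] by auto
  show ?case
  proof (cases "e = 0")
    case True
    then show ?thesis using eu(1) eu'(1) same by (auto dest: migt_steps_greater)
  next
    case False
    then have "(e, u) \<in> set (migt_steps G v 0)" "(e, u) \<in> set (migt_steps G v' 0)"
      using eu(1) eu'(1) same by auto
    moreover have "e < i" using eu(2) by (simp add: next_dart_def)
    ultimately show ?thesis using less.IH by blast
  qed
qed

section \<open>The mind-body dual\<close>

lemma trail_edges_migt: "trail_edges (migt G v) = map fst (migt_steps G v 0)"
  by (simp add: trail_edges_def migt_def)

lemma migt_eq_iff [simp]: "migt G v = migt G w \<longleftrightarrow> v = w"
  by (auto simp: migt_def)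

lemma eedges_dual [simp]: "eedges (mind_body_dual G) = eedges G"
  by (simp add: eedges_def mind_body_dual_def)

lemma everts_dual [simp]: "everts (mind_body_dual G) = migt G ` everts G"
  by (simp add: mind_body_dual_def)

lemma ends_dual [simp]:
  "ends (mind_body_dual G) i = {t \<in> migt G ` everts G. i \<in> set (trail_edges t)}"
  by (simp add: mind_body_dual_def)

text \<open>The two darts of an edge lie on one migt each. The two migts differ, since a migt traverses an edge
  at most once.\<close>

lemma is_egraph_dual:
  assumes "is_egraph G"
  shows "is_egraph (mind_body_dual G)"
  unfolding is_egraph_def
proof (intro conjI ballI)
  show "finite (everts (mind_body_dual G))" using assms by (simp add: is_egraph_def)
next
  fix i assume "i \<in> eedges (mind_body_dual G)"
  then have i: "i \<in> eedges G" by simp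
  show "ends (mind_body_dual G) i \<subseteq> everts (mind_body_dual G)" by auto
  obtain w1 w2 where w: "ends G i = {w1, w2}" "w1 \<noteq> w2"
    using assms i by (auto simp: is_egraph_def card_2_iff)
  then obtain v1 v2 where v: "v1 \<in> everts G" "v2 \<in> everts G"
    "(i, w1) \<in> set (migt_steps G v1 0)" "(i, w2) \<in> set (migt_steps G v2 0)"
    using dart_in_migt[OF assms i] by (metis insertCI)
  have "v1 \<noteq> v2" using migt_steps_unique_arrival v(3,4) w(2) by metis
  have only: "v = v1 \<or> v = v2" if "(i, w) \<in> set (migt_steps G v 0)" for v w
  proof -
    have "w \<in> ends G i" using migt_steps_dart[OF assms that] by blast
    then have "w = w1 \<or> w = w2" using w(1) by simp
    then show ?thesis using dart_migt_unique[OF assms] that v(3,4) by metis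
  qed
  have "i \<in> set (trail_edges (migt G v)) \<longleftrightarrow> v = v1 \<or> v = v2" for v
  proof -
    have "i \<in> set (trail_edges (migt G v)) \<longleftrightarrow> (\<exists>w. (i, w) \<in> set (migt_steps G v 0))"
      by (force simp: trail_edges_migt)
    then show ?thesis using only v(3,4) by blast
  qed
  then have "ends (mind_body_dual G) i = {migt G v1, migt G v2}" using v(1,2) by auto
  then show "card (ends (mind_body_dual G) i) = 2" using \<open>v1 \<noteq> v2\<close> by simp
qed

lemma leo_dual:
  assumes "is_egraph G" "v \<in> everts G"
  shows "leo (mind_body_dual G) (migt G v) = trail_edges (migt G v)"
proof -
  have "{i \<in> eedges G. i \<in> set (trail_edges (migt G v))} = set (trail_edges (migt G v))"
    using migt_steps_dart(1)[OF assms(1)] by (auto simp: trail_edges_migt)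
  then have "leo (mind_body_dual G) (migt G v) = sorted_list_of_set (set (trail_edges (migt G v)))"
    using assms(2) by (simp add: leo_def)
  also have "\<dots> = trail_edges (migt G v)"
    using migt_steps_sorted[of G v 0] strict_sorted_iff unfolding trail_edges_migt
    by (intro sorted_list_of_set.idem_if_sorted_distinct) blast+
  finally show ?thesis .
qed

section \<open>The medial digraph\<close>

lemma medial_simps [simp]:
  "verts (medial G) = eedges G"
  "tail (medial G) (v, e, f) = e" "head (medial G) (v, e, f) = f"
  "(v, e, f) \<in> arcs (medial G) \<longleftrightarrow> v \<in> everts G \<and> (e, f) \<in> set (consecutive (leo G v))"
  by (simp_all add: medial_def)

lemma wf_medial: "wf_digraph (medial G)"
proof
  fix x assume "x \<in> arcs (medial G)"
  then show "tail (medial G) x \<in> verts (medial G)" "head (medial G) x \<in> verts (medial G)"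
    by (cases x; auto dest: in_set_consecutiveD)+
qed

text \<open>The arc \<open>e \<rightarrow> f\<close> contributed by \<open>w\<close> records that a trail arriving at \<open>w\<close> along \<open>e\<close> continues with
  \<open>f\<close>. This is the link between medial digraphs and migts.\<close>

lemma medial_arc_iff:
  assumes "is_egraph G"
  shows "(w, e, f) \<in> arcs (medial G) \<longleftrightarrow>
    e \<in> set (leo G w) \<and> next_dart G (e, w) (f, other_end G f w)"
  using assms consecutive_strict_sorted_iff[OF leo_sorted, of e f G w]
  by (auto simp: next_dart_def is_egraph_def)

lemma leo_chain_walk:
  assumes "xs \<noteq> []"
  shows "pre_digraph.awalk_verts (medial G) (hd xs) (map (Pair v) (consecutive xs)) = xs"
    "pre_digraph.cas (medial G) (hd xs) (map (Pair v) (consecutive xs)) (last xs)"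
  using assms
  by (induction xs rule: induct_list012)
    (auto simp: pre_digraph.awalk_verts.simps pre_digraph.cas.simps)

lemma size_filter_image_mset_set:
  assumes "finite A"
  shows "size (filter_mset P (image_mset f (mset_set A))) = card {a \<in> A. P (f a)}"
  using assms by (simp add: filter_mset_image_mset)

text \<open>An arc lies only on the chain of the vertex contributing it, and an edge lies on the chains of its
  two ends. The same statement for the mind-body dual is what yields the PCD induced by its order.\<close>

lemma is_pcd_leo_pcd:
  assumes "is_egraph G"
  shows "is_pcd (medial G) (leo_pcd G)"
proof -
  let ?A = "{v \<in> everts G. leo G v \<noteq> []}"
  have fin: "finite ?A" using assms by (simp add: is_egraph_def)
  have verts: "chain_verts (medial G) (leo_chain G v) = set (leo G v)" if "leo G v \<noteq> []" for v
    using leo_chain_walk(1)[OF that, of G v]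
    by (simp add: chain_verts_def leo_chain_def del: set_leo)
  show ?thesis unfolding is_pcd_def
  proof (intro conjI ballI)
    fix c assume "c \<in># leo_pcd G"
    then obtain v where v: "c = leo_chain G v" "v \<in> everts G" "leo G v \<noteq> []"
      using fin by (auto simp: leo_pcd_def)
    have "hd (leo G v) \<in> eedges G" using hd_in_set[OF v(3)] by simp
    then show "is_chain (medial G) c"
      using leo_chain_walk[OF v(3), of G v] leo_distinct[of G v] v(1,2)
      by (auto simp: is_chain_def pre_digraph.apath_def pre_digraph.awalk_def leo_chain_def)
  next
    fix x assume "x \<in> arcs (medial G)"
    moreover obtain v e f where x: "x = (v, e, f)" by (cases x)
    ultimately have "v \<in> everts G" "(e, f) \<in> set (consecutive (leo G v))" by auto
    then have "{v \<in> ?A. x \<in> set (snd (leo_chain G v))} = {v}"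
      by (auto simp: leo_chain_def x)
    then show "size (filter_mset (\<lambda>c. x \<in> set (snd c)) (leo_pcd G)) = 1"
      unfolding leo_pcd_def size_filter_image_mset_set[OF fin] by simp
  next
    fix a assume "a \<in> verts (medial G)"
    then have a: "a \<in> eedges G" by simp
    have "leo G v \<noteq> []" if "v \<in> ends G a" for v
    proof -
      have "a \<in> set (leo G v)" using that a by simp
      then show ?thesis by force
    qed
    then have "{v \<in> ?A. a \<in> chain_verts (medial G) (leo_chain G v)} = ends G a"
      using a assms verts by (auto simp: is_egraph_def)
    then show "size (filter_mset (\<lambda>c. a \<in> chain_verts (medial G) c) (leo_pcd G)) = 2"
      unfolding leo_pcd_def size_filter_image_mset_set[OF fin]
      using a assms by (simp add: is_egraph_def)
  qed
qed

section \<open>The canonical identification\<close>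

lemma iso_arcs_medial_ident:
  assumes "(f, w) \<in> set (migt_steps G v 0)"
  shows "iso_arcs medial_ident (migt G v, f, g) = (w, f, g)"
  using assms map_of_is_SomeI[OF migt_steps_distinct(1) assms]
  by (simp add: medial_ident_def migt_def)

lemma dual_arc_iff:
  assumes "is_egraph G"
  shows "(t, f, g) \<in> arcs (medial (mind_body_dual G)) \<longleftrightarrow>
    (\<exists>v \<in> everts G. t = migt G v \<and>
      (\<exists>w. (f, w) \<in> set (migt_steps G v 0) \<and> next_dart G (f, w) (g, other_end G g w)))"
proof -
  have "(f, g) \<in> set (consecutive (trail_edges (migt G v))) \<longleftrightarrow>
    (\<exists>w. (f, w) \<in> set (migt_steps G v 0) \<and> next_dart G (f, w) (g, other_end G g w))" for v
  proof -
    have "(f, g) \<in> set (consecutive (trail_edges (migt G v))) \<longleftrightarrow>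
      (\<exists>w u. ((f, w), (g, u)) \<in> set (consecutive (migt_steps G v 0)))"
      unfolding trail_edges_migt consecutive_map by force
    also have "\<dots> \<longleftrightarrow>
      (\<exists>w. (f, w) \<in> set (migt_steps G v 0) \<and> next_dart G (f, w) (g, other_end G g w))"
      unfolding consecutive_migt_steps_iff by (auto simp: next_dart_def)
    finally show ?thesis .
  qed
  then show ?thesis using leo_dual[OF assms] by auto
qed

text \<open>Each dart lies on a migt, which passes through every arc that leaves from it.\<close>

lemma iso_arcs_image:
  assumes "is_egraph G"
  shows "iso_arcs medial_ident ` arcs (medial (mind_body_dual G)) = arcs (medial G)"
proof (intro equalityI subsetI)
  fix x assume "x \<in> iso_arcs medial_ident ` arcs (medial (mind_body_dual G))"
  then obtain t f g where tfg: "(t, f, g) \<in> arcs (medial (mind_body_dual G))"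
    "x = iso_arcs medial_ident (t, f, g)" by auto
  from tfg(1) obtain v w where v: "t = migt G v" "(f, w) \<in> set (migt_steps G v 0)"
    "next_dart G (f, w) (g, other_end G g w)"
    unfolding dual_arc_iff[OF assms] by blast
  have "x = (w, f, g)" using tfg(2) v(1) iso_arcs_medial_ident[OF v(2)] by simp
  then show "x \<in> arcs (medial G)"
    using v(3) migt_steps_dart[OF assms v(2)] medial_arc_iff[OF assms, of w f g]
    by (simp del: medial_simps)
next
  fix x assume x: "x \<in> arcs (medial G)"
  obtain w f g where "x = (w, f, g)" by (cases x)
  with x have *: "x = (w, f, g)" "f \<in> set (leo G w)" "next_dart G (f, w) (g, other_end G g w)"
    using medial_arc_iff[OF assms] by blast+
  then obtain v where v: "v \<in> everts G" "(f, w) \<in> set (migt_steps G v 0)"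
    using dart_in_migt[OF assms, of f w] by auto
  then have "(migt G v, f, g) \<in> arcs (medial (mind_body_dual G))"
    using * unfolding dual_arc_iff[OF assms] by blast
  moreover have "x = iso_arcs medial_ident (migt G v, f, g)"
    using iso_arcs_medial_ident[OF v(2), of g] *(1) by simp
  ultimately show "x \<in> iso_arcs medial_ident ` arcs (medial (mind_body_dual G))"
    by (rule rev_image_eqI)
qed

lemma app_iso_medial_ident:
  assumes "is_egraph G"
  shows "app_iso medial_ident (medial (mind_body_dual G)) = medial G"
  by (rule pre_digraph.equality)
    (use iso_arcs_image[OF assms] in \<open>auto simp: app_iso_def medial_ident_def medial_def\<close>)

text \<open>The image \<open>(w, f, g)\<close> of an arc contributed by a migt contains the dart \<open>(f, w)\<close>, and the dart
  determines the migt.\<close>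

lemma digraph_isomorphism_medial_ident:
  assumes "is_egraph G"
  shows "pre_digraph.digraph_isomorphism (medial (mind_body_dual G)) medial_ident"
  unfolding pre_digraph.digraph_isomorphism_def
proof (intro conjI ballI)
  show "wf_digraph (medial (mind_body_dual G))" by (rule wf_medial)
  show "inj_on (iso_verts medial_ident) (verts (medial (mind_body_dual G)))"
    by (simp add: medial_ident_def)
  show "inj_on (iso_arcs medial_ident) (arcs (medial (mind_body_dual G)))"
  proof (rule inj_onI)
    fix x y assume xy: "x \<in> arcs (medial (mind_body_dual G))" "y \<in> arcs (medial (mind_body_dual G))"
      "iso_arcs medial_ident x = iso_arcs medial_ident y"
    obtain t f g t' f' g' where eq: "x = (t, f, g)" "y = (t', f', g')" by (cases x, cases y)
    from xy(1) obtain v w where v: "t = migt G v" "(f, w) \<in> set (migt_steps G v 0)"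
      unfolding eq dual_arc_iff[OF assms] by blast
    from xy(2) obtain v' w' where v': "t' = migt G v'" "(f', w') \<in> set (migt_steps G v' 0)"
      unfolding eq dual_arc_iff[OF assms] by blast
    have "w = w'" "f = f'" "g = g'"
      using xy(3) iso_arcs_medial_ident[OF v(2), of g] iso_arcs_medial_ident[OF v'(2), of g']
      unfolding eq v(1) v'(1) by auto
    then show "x = y" using dart_migt_unique[OF assms, of f w v v'] v v' eq by simp
  qed
  fix x assume "x \<in> arcs (medial (mind_body_dual G))"
  show "iso_verts medial_ident (tail (medial (mind_body_dual G)) x) =
      iso_tail medial_ident (iso_arcs medial_ident x)"
    "iso_verts medial_ident (head (medial (mind_body_dual G)) x) =
      iso_head medial_ident (iso_arcs medial_ident x)"
    by (cases x; simp add: medial_ident_def)+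
qed

section \<open>The two choices at a vertex of the medial digraph\<close>

lemma leo_pcd_choice_iff:
  assumes "is_egraph G" "(v, e, a) \<in> arcs (medial G)" "(w, a, g) \<in> arcs (medial G)"
  shows "((v, e, a), (w, a, g)) \<in> pcd_choice (medial G) (leo_pcd G) a \<longleftrightarrow> v = w"
proof -
  have fin: "finite {v \<in> everts G. leo G v \<noteq> []}" using assms by (simp add: is_egraph_def)
  have arcs: "v \<in> everts G" "(e, a) \<in> set (consecutive (leo G v))"
    "(a, g) \<in> set (consecutive (leo G w))"
    using assms(2,3) by auto
  have "((v, e, a), (w, a, g)) \<in> pcd_choice (medial G) (leo_pcd G) a \<longleftrightarrow>
    (\<exists>u \<in> everts G. leo G u \<noteq> [] \<and>
      ((v, e, a), (w, a, g)) \<in> map_prod (Pair u) (Pair u) ` set (consecutive (consecutive (leo G u))))"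
    using fin by (auto simp: pcd_choice_def leo_pcd_def leo_chain_def consecutive_map)
  also have "\<dots> \<longleftrightarrow> (\<exists>u \<in> everts G. leo G u \<noteq> [] \<and> v = u \<and> w = u \<and>
      ((e, a), (a, g)) \<in> set (consecutive (consecutive (leo G u))))"
    by (intro bex_cong refl conj_cong) auto
  also have "\<dots> \<longleftrightarrow> v = w"
    using arcs by (auto simp: consecutive_consecutive_iff[OF leo_distinct])
  finally show ?thesis .
qed

lemma dual_chain_arcs:
  assumes "is_egraph G" "v \<in> everts G"
  shows "map (iso_arcs medial_ident) (snd (leo_chain (mind_body_dual G) (migt G v))) =
    map (\<lambda>(d, d'). (snd d, fst d, fst d')) (consecutive (migt_steps G v 0))"
proof -
  have "iso_arcs medial_ident (migt G v, fst d, fst d') = (snd d, fst d, fst d')"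
    if "(d, d') \<in> set (consecutive (migt_steps G v 0))" for d d'
    using in_set_consecutiveD[OF that] iso_arcs_medial_ident[of "fst d" "snd d" G v] by simp
  then show ?thesis
    unfolding leo_chain_def snd_conv leo_dual[OF assms] trail_edges_migt consecutive_map by auto
qed

text \<open>The migt through the dart \<open>(e, v)\<close> next traverses \<open>a\<close> away from \<open>v\<close>. It therefore continues with an
  arc contributed by the end of \<open>a\<close> other than \<open>v\<close>, which is \<open>w\<close> exactly if \<open>v \<noteq> w\<close>.\<close>

lemma leo_pcd_dual_choice_iff:
  assumes "is_egraph G" "(v, e, a) \<in> arcs (medial G)" "(w, a, g) \<in> arcs (medial G)"
  shows "((v, e, a), (w, a, g)) \<in>
      pcd_choice (medial G) (map_pcd medial_ident (leo_pcd (mind_body_dual G))) a \<longleftrightarrow> v \<noteq> w"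
proof -
  let ?G = "mind_body_dual G"
  let ?x = "(v, e, a)" and ?y = "(w, a, g)"
  let ?h = "\<lambda>(d :: nat \<times> 'a, d' :: nat \<times> 'a). (snd d, fst d, fst d')"
  have fin: "finite {t \<in> everts ?G. leo ?G t \<noteq> []}"
    using assms by (simp add: is_egraph_def)
  have arcs: "e \<in> set (leo G v)" "next_dart G (e, v) (a, other_end G a v)"
    "a \<in> set (leo G w)" "next_dart G (a, w) (g, other_end G g w)"
    using assms(2,3) unfolding medial_arc_iff[OF assms(1)] by blast+
  have a: "a \<in> eedges G" "v \<in> ends G a" "w \<in> ends G a" using arcs(2,3) by (auto simp: next_dart_def)
  have in_chain: "(?x, ?y) \<in> set (consecutive
      (map (iso_arcs medial_ident) (snd (leo_chain ?G (migt G u))))) \<longleftrightarrow>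
    (e, v) \<in> set (migt_steps G u 0) \<and> v \<noteq> w" (is "?L \<longleftrightarrow> ?R") if u: "u \<in> everts G" for u
  proof
    assume ?L
    then obtain d d' b b' where *:
      "((d, d'), (b, b')) \<in> set (consecutive (consecutive (migt_steps G u 0)))"
      "?x = (snd d, fst d, fst d')" "?y = (snd b, fst b, fst b')"
      unfolding dual_chain_arcs[OF assms(1) u] consecutive_map by auto
    then have "d' = b" "d \<in> set (migt_steps G u 0)" "next_dart G d d'"
      unfolding consecutive_consecutive_iff[OF migt_steps_distinct(2)] consecutive_migt_steps_iff
      by auto
    with * have "(e, v) \<in> set (migt_steps G u 0)" "w = other_end G a v"
      by (auto simp: next_dart_def)
    with other_end(2)[OF assms(1) a(1,2)] show ?R by auto
  next
    assume R: ?R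
    then have w: "other_end G a v = w" using other_end(1)[OF assms(1) a(1,2)] a(3) by auto
    have "(a, w) \<in> set (migt_steps G u 0)"
      using migt_steps_next[OF _ arcs(2), of 0 u] R w by auto
    then have "(((e, v), (a, w)), ((a, w), (g, other_end G g w))) \<in>
        set (consecutive (consecutive (migt_steps G u 0)))"
      unfolding consecutive_consecutive_iff[OF migt_steps_distinct(2)] consecutive_migt_steps_iff
      using R arcs w by simp
    then have "map_prod ?h ?h (((e, v), (a, w)), ((a, w), (g, other_end G g w))) \<in>
        map_prod ?h ?h ` set (consecutive (consecutive (migt_steps G u 0)))"
      by (rule imageI)
    then show ?L
      unfolding dual_chain_arcs[OF assms(1) u] consecutive_map set_map by simp
  qed
  obtain u where u: "u \<in> everts G" "(e, v) \<in> set (migt_steps G u 0)"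
    using dart_in_migt[OF assms(1), of e v] arcs(1) by auto
  then have ne: "leo ?G (migt G u) \<noteq> []"
    using leo_dual[OF assms(1) u(1)] by (auto simp: trail_edges_migt)
  have "(?x, ?y) \<in> pcd_choice (medial G) (map_pcd medial_ident (leo_pcd ?G)) a \<longleftrightarrow>
    (\<exists>u \<in> everts G. leo ?G (migt G u) \<noteq> [] \<and> (?x, ?y) \<in> set (consecutive
      (map (iso_arcs medial_ident) (snd (leo_chain ?G (migt G u))))))"
    using fin by (auto simp: pcd_choice_def map_pcd_def leo_pcd_def)
  also have "\<dots> \<longleftrightarrow> v \<noteq> w" using in_chain u ne by blast
  finally show ?thesis .
qed

text \<open>At an internal vertex take any incoming and any outgoing arc: exactly one of the two PCDs continues
  the former by the latter.\<close>

lemma is_dual_pcd_leo_pcd_dual: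
  assumes "is_egraph G"
  shows "is_dual_pcd (medial G) (leo_pcd G) (map_pcd medial_ident (leo_pcd (mind_body_dual G)))"
  unfolding is_dual_pcd_def
proof (intro conjI allI impI)
  show "is_pcd (medial G) (map_pcd medial_ident (leo_pcd (mind_body_dual G)))"
    using is_pcd_map_pcd[OF wf_medial digraph_isomorphism_medial_ident[OF assms]
        is_pcd_leo_pcd[OF is_egraph_dual[OF assms]]]
    unfolding app_iso_medial_ident[OF assms] .
next
  fix a assume "internal (medial G) a"
  then have "in_arcs (medial G) a \<noteq> {}" "out_arcs (medial G) a \<noteq> {}"
    by (auto simp: internal_def in_degree_def out_degree_def)
  then obtain v e w g where arcs: "(v, e, a) \<in> arcs (medial G)" "(w, a, g) \<in> arcs (medial G)"
    by (auto simp: in_arcs_def out_arcs_def)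
  show "pcd_choice (medial G) (map_pcd medial_ident (leo_pcd (mind_body_dual G))) a \<noteq>
      pcd_choice (medial G) (leo_pcd G) a"
    using leo_pcd_choice_iff[OF assms arcs] leo_pcd_dual_choice_iff[OF assms arcs] by blast
qed

theorem theorem2p20:
  fixes \<Gamma> :: "'v egraph"
  assumes "is_egraph \<Gamma>"
  shows "is_egraph (mind_body_dual \<Gamma>) \<and>
    pre_digraph.digraph_isomorphism (medial (mind_body_dual \<Gamma>)) medial_ident \<and>
    app_iso medial_ident (medial (mind_body_dual \<Gamma>)) = medial \<Gamma> \<and>
    is_pcd (medial \<Gamma>) (leo_pcd \<Gamma>) \<and>
    is_dual_pcd (medial \<Gamma>) (leo_pcd \<Gamma>) (map_pcd medial_ident (leo_pcd (mind_body_dual \<Gamma>))) \<and>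
    map_pcd medial_ident (leo_pcd (mind_body_dual \<Gamma>)) = dual_pcd (medial \<Gamma>) (leo_pcd \<Gamma>)"
  using is_egraph_dual[OF assms] digraph_isomorphism_medial_ident[OF assms]
    app_iso_medial_ident[OF assms] is_pcd_leo_pcd[OF assms] is_dual_pcd_leo_pcd_dual[OF assms]
    dual_pcd_eqI[OF wf_medial is_pcd_leo_pcd[OF assms] is_dual_pcd_leo_pcd_dual[OF assms]]
  by simp

end
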